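(* Let $X$ be a Lie rack, $\mathfrak x=T_1X$ its Leibniz algebra, $A$ an abelian Lie group and $\mathfrak a$ its Lie algebra. If $(A,\phi,\psi)$ is a smooth symmetric (resp. anti-symmetric) $X$-module, then $(\mathfrak a,[-,-]_L,[-,-]_R)$ is a symmetric (resp. anti-symmetric) representation of the Leibniz algebra $\mathfrak x$, where $$[u,m]_L=T_{(1,1)}\epsilon(u,0)(m),\qquad [m,u]_R=T_{(1,1)}\chi(0,u)(m),$$ with $\epsilon:X\times X\to Aut(\mathfrak a)$, $\epsilon(x,y)=T_0\phi_{x,y}$, and $\chi:X\times X\to End(\mathfrak a)$, $\chi(x,y)=T_0\psi_{x,y}$ (tangent maps at the neutral element of $A$).
   Context: A pointed rack is a set $X$ with a product $\rhd$ and an element $1$ such that every $x\rhd-$ is a bijection, $x\rhd(y\rhd z)=(x\rhd y)\rhd(x\rhd z)$, $1\rhd x=x$ and $x\rhd1=1$. A Lie rack is a smooth manifold with a pointed rack structure with smooth product such that each $c_x=x\rhd-$ is a diffeomorphism. Its Leibniz algebra is $\mathfrak x=T_1X$ with bracket $[u,v]=ad(u)(v)$, $ad=T_1Ad$, $Ad_x=T_1c_x$; it satisfies $[x,[y,z]]=[[x,y],z]+[y,[x,z]]$. Let $A$ be an abelian Lie group and $\rho$ assign to each $x\in X$ an automorphism $\rho_x$ of $A$ with $\rho_{x\rhd y}=\rho_x\rho_y\rho_x^{-1}$, $\rho_1=id$ and $X\times A\to A$, $(x,a)\mapsto\rho_x(a)$ smooth. The associated smooth symmetric $X$-module is $(A,\phi,\psi)$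 with $\phi_{x,y}(a)=\rho_x(a)$, $\psi_{x,y}(a)=a-\rho_{x\rhd y}(a)$; the associated smooth anti-symmetric $X$-module has $\phi_{x,y}(a)=\rho_x(a)$, $\psi_{x,y}=0$. A smooth symmetric (resp. anti-symmetric) $X$-module is one obtained this way. A representation of a Leibniz algebra $\mathfrak x$ is a vector space $M$ with bilinear maps $[-,-]_L:\mathfrak x\times M\to M$, $[-,-]_R:M\times\mathfrak x\to M$ satisfying $[x,[y,m]_L]_L=[[x,y],m]_L+[y,[x,m]_L]_L$, $[x,[m,y]_R]_L=[[x,m]_L,y]_R+[m,[x,y]]_R$, $[m,[x,y]]_R=[[m,x]_R,y]_R+[x,[m,y]_R]_L$. It is symmetric if $[x,m]_L=-[m,x]_R$ for all $x,m$, and anti-symmetric if $[-,-]_R=0$. *)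

theory Defs
  imports "HOL-Analysis.Analysis"
begin

section \<open>Model spaces and smooth maps between them\<close>

text \<open>
  The spaces \<open>\<real>\<^sup>n\<close> with \<open>n = 0\<close> included: the axioms are those of \<^class>\<open>euclidean_space\<close>
  without nonemptiness of the orthonormal basis, so that zero-dimensional manifolds are covered.
\<close>

class model_space = real_inner +
  assumes ex_orthonormal_basis:
    "\<exists>B. finite B \<and> (\<forall>u\<in>B. \<forall>v\<in>B. inner u v = (if u = v then 1 else 0)) \<and>
         (\<forall>x. (\<forall>u\<in>B. inner x u = 0) \<longleftrightarrow> x = 0)"

subclass (in euclidean_space) model_space
proof
  show "\<exists>B. finite B \<and> (\<forall>u\<in>B. \<forall>v\<in>B. inner u v = (if u = v then 1 else 0)) \<and>
         (\<forall>x. (\<forall>u\<in>B. inner x u = 0) \<longleftrightarrow> x = 0)"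
    by (rule exI[of _ Basis]) (simp add: inner_Basis euclidean_all_zero_iff)
qed

text \<open>
  \<open>C\<^sup>k\<close> on an open subset of a finite-dimensional space, by iterated directional derivatives.
\<close>

fun Ck_on :: "nat \<Rightarrow> 'e::real_normed_vector set \<Rightarrow> ('e \<Rightarrow> 'f::real_normed_vector) \<Rightarrow> bool" where
  "Ck_on 0 S f \<longleftrightarrow> continuous_on S f"
| "Ck_on (Suc k) S f \<longleftrightarrow>
     (\<forall>x\<in>S. f differentiable (at x)) \<and> (\<forall>v. Ck_on k S (\<lambda>x. frechet_derivative f (at x) v))"

definition smooth_on :: "'e::real_normed_vector set \<Rightarrow> ('e \<Rightarrow> 'f::real_normed_vector) \<Rightarrow> bool" where
  "smooth_on S f \<longleftrightarrow> (\<forall>k. Ck_on k S f)"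

section \<open>Smooth manifolds\<close>

text \<open>
  A chart is a pair of its domain and its coordinate map; values of the coordinate map outside
  the domain are irrelevant. A manifold consists of all points of the type \<open>'x\<close>, with the topology
  of the type class. Besides the atlas it records one chart around every point. That chart is
  used only to identify the tangent space at the point with the model space (see below); it is
  arbitrary, so that results hold for every choice of coordinates.
\<close>

type_synonym ('x, 'e) chart = "'x set \<times> ('x \<Rightarrow> 'e)"

definition chart_inv :: "('x, 'e) chart \<Rightarrow> 'e \<Rightarrow> 'x" where
  "chart_inv c = inv_into (fst c) (snd c)"

definition is_chart :: "('x::topological_space, 'e::real_normed_vector) chart \<Rightarrow> bool" where
  "is_chart c \<longleftrightarrow> open (fst c) \<and> open (snd c ` fst c) \<and>
     homeomorphism (fst c) (snd c ` fst c) (snd c) (chart_inv c)"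

definition in_charts ::
  "('x, 'e) chart \<Rightarrow> ('y, 'f) chart \<Rightarrow> ('x \<Rightarrow> 'y) \<Rightarrow> 'e \<Rightarrow> 'f" where
  "in_charts c d f = snd d \<circ> f \<circ> chart_inv c"

record ('x, 'e) charted =
  atlas :: "('x, 'e) chart set"
  chart_at :: "'x \<Rightarrow> ('x, 'e) chart"

locale smooth_manifold =
  fixes M :: "('x::{t2_space, second_countable_topology}, 'e::model_space) charted"
  assumes is_chart: "c \<in> atlas M \<Longrightarrow> is_chart c"
    and chart_at_in_atlas: "chart_at M p \<in> atlas M"
    and in_chart_at: "p \<in> fst (chart_at M p)"
    and compatible: "c \<in> atlas M \<Longrightarrow> d \<in> atlas M \<Longrightarrow>
      smooth_on (snd c ` (fst c \<inter> fst d)) (in_charts c d (\<lambda>p. p))"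

definition prod_manifold ::
  "('x, 'e) charted \<Rightarrow> ('y, 'f) charted \<Rightarrow> ('x \<times> 'y, 'e \<times> 'f) charted" (infixr "\<times>\<^sub>M" 80) where
  "M \<times>\<^sub>M N =
     \<lparr>atlas = {(fst c \<times> fst d, map_prod (snd c) (snd d)) | c d. c \<in> atlas M \<and> d \<in> atlas N},
      chart_at = (\<lambda>(p, q). (fst (chart_at M p) \<times> fst (chart_at N q),
                            map_prod (snd (chart_at M p)) (snd (chart_at N q))))\<rparr>"

definition vector_manifold :: "('w::real_normed_vector, 'w) charted" where
  "vector_manifold = \<lparr>atlas = {(UNIV, \<lambda>w. w)}, chart_at = (\<lambda>_. (UNIV, \<lambda>w. w))\<rparr>"

definition smooth_map ::
  "('x::topological_space, 'e::real_normed_vector) charted \<Rightarrow>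
   ('y::topological_space, 'f::real_normed_vector) charted \<Rightarrow> ('x \<Rightarrow> 'y) \<Rightarrow> bool" where
  "smooth_map M N f \<longleftrightarrow> continuous_on UNIV f \<and>
     (\<forall>c\<in>atlas M. \<forall>d\<in>atlas N.
        smooth_on (snd c ` (fst c \<inter> f -` fst d)) (in_charts c d f))"

definition diffeomorphism ::
  "('x::topological_space, 'e::real_normed_vector) charted \<Rightarrow>
   ('y::topological_space, 'f::real_normed_vector) charted \<Rightarrow> ('x \<Rightarrow> 'y) \<Rightarrow> bool" where
  "diffeomorphism M N f \<longleftrightarrow> bij f \<and> smooth_map M N f \<and> smooth_map N M (inv f)"

text \<open>
  The tangent space \<open>T\<^sub>pM\<close> is the model space \<open>'e\<close>, a tangent vector being given by its
  coordinates with respect to \<open>chart_at M p\<close>. Hence the tangent map \<open>T\<^sub>pf : T\<^sub>pM \<rightarrow> T\<^sub>f\<^sub>(\<^sub>p\<^sub>)N\<close> is the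
  derivative of \<open>f\<close> read in the charts at \<open>p\<close> and at \<open>f p\<close>. Moreover
  \<open>T\<^sub>(\<^sub>p\<^sub>,\<^sub>q\<^sub>)(M \<times>\<^sub>M N) = T\<^sub>pM \<times> T\<^sub>qN\<close>, and the tangent spaces of a vector space are that space itself.
  The space \<open>End(T\<^sub>pM)\<close> is the type of bounded linear maps on \<open>'e\<close> (in finite dimension all linear
  maps are bounded), regarded as a manifold via \<^const>\<open>vector_manifold\<close>. The value of
  \<^const>\<open>Blinfun\<close> below is meaningful whenever \<open>f\<close> is smooth.
\<close>

definition tangent_map ::
  "('x, 'e::real_normed_vector) charted \<Rightarrow> ('y, 'f::real_normed_vector) charted \<Rightarrow>
   ('x \<Rightarrow> 'y) \<Rightarrow> 'x \<Rightarrow> 'e \<Rightarrow>\<^sub>L 'f" where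
  "tangent_map M N f p =
     Blinfun (frechet_derivative (in_charts (chart_at M p) (chart_at N (f p)) f)
                (at (snd (chart_at M p) p)))"

section \<open>Lie racks and their modules\<close>

locale pointed_rack =
  fixes rack :: "'x \<Rightarrow> 'x \<Rightarrow> 'x" (infixr "\<rhd>" 75)
    and one :: 'x ("\<one>")
  assumes bij: "bij ((\<rhd>) x)"
    and self_distrib: "x \<rhd> (y \<rhd> z) = (x \<rhd> y) \<rhd> (x \<rhd> z)"
    and one_left: "\<one> \<rhd> x = x"
    and one_right: "x \<rhd> \<one> = \<one>"

locale lie_rack = smooth_manifold X + pointed_rack rack one
  for X :: "('x::{t2_space, second_countable_topology}, 'e::model_space) charted"
    and rack :: "'x \<Rightarrow> 'x \<Rightarrow> 'x" (infixr "\<rhd>" 75)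
    and one :: 'x ("\<one>") +
  assumes smooth_rack: "smooth_map (X \<times>\<^sub>M X) X (\<lambda>(x, y). x \<rhd> y)"
    and diffeo: "diffeomorphism X X ((\<rhd>) x)"

definition rack_Ad ::
  "('x, 'e::real_normed_vector) charted \<Rightarrow> ('x \<Rightarrow> 'x \<Rightarrow> 'x) \<Rightarrow> 'x \<Rightarrow> 'x \<Rightarrow> 'e \<Rightarrow>\<^sub>L 'e" where
  "rack_Ad X rack one x = tangent_map X X (rack x) one"

definition rack_ad ::
  "('x, 'e::real_normed_vector) charted \<Rightarrow> ('x \<Rightarrow> 'x \<Rightarrow> 'x) \<Rightarrow> 'x \<Rightarrow> 'e \<Rightarrow>\<^sub>L ('e \<Rightarrow>\<^sub>L 'e)" where
  "rack_ad X rack one = tangent_map X vector_manifold (rack_Ad X rack one) one"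

definition rack_bracket ::
  "('x, 'e::real_normed_vector) charted \<Rightarrow> ('x \<Rightarrow> 'x \<Rightarrow> 'x) \<Rightarrow> 'x \<Rightarrow> 'e \<Rightarrow> 'e \<Rightarrow> 'e" where
  "rack_bracket X rack one u v = blinfun_apply (blinfun_apply (rack_ad X rack one) u) v"

locale abelian_lie_group = smooth_manifold A
  for A :: "('a::{ab_group_add, t2_space, second_countable_topology}, 'f::model_space) charted" +
  assumes smooth_add: "smooth_map (A \<times>\<^sub>M A) A (\<lambda>(a, b). a + b)"
    and smooth_uminus: "smooth_map A A uminus"

definition lie_group_automorphism ::
  "('a::{ab_group_add, topological_space}, 'f::real_normed_vector) charted \<Rightarrow> ('a \<Rightarrow> 'a) \<Rightarrow> bool"
  where
  "lie_group_automorphism A f \<longleftrightarrow> diffeomorphism A A f \<and> (\<forall>a b. f (a + b) = f a + f b)"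

definition smooth_rack_action ::
  "('x::topological_space, 'e::real_normed_vector) charted \<Rightarrow> ('x \<Rightarrow> 'x \<Rightarrow> 'x) \<Rightarrow> 'x \<Rightarrow>
   ('a::{ab_group_add, topological_space}, 'f::real_normed_vector) charted \<Rightarrow>
   ('x \<Rightarrow> 'a \<Rightarrow> 'a) \<Rightarrow> bool" where
  "smooth_rack_action X rack one A \<rho> \<longleftrightarrow>
     (\<forall>x. lie_group_automorphism A (\<rho> x)) \<and>
     (\<forall>x y. \<rho> (rack x y) = \<rho> x \<circ> \<rho> y \<circ> inv (\<rho> x)) \<and>
     \<rho> one = id \<and>
     smooth_map (X \<times>\<^sub>M A) A (\<lambda>(x, a). \<rho> x a)"

definition smooth_symmetric_module ::
  "('x::topological_space, 'e::real_normed_vector) charted \<Rightarrow> ('x \<Rightarrow> 'x \<Rightarrow> 'x) \<Rightarrow> 'x \<Rightarrow>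
   ('a::{ab_group_add, topological_space}, 'f::real_normed_vector) charted \<Rightarrow>
   ('x \<Rightarrow> 'x \<Rightarrow> 'a \<Rightarrow> 'a) \<Rightarrow> ('x \<Rightarrow> 'x \<Rightarrow> 'a \<Rightarrow> 'a) \<Rightarrow> bool" where
  "smooth_symmetric_module X rack one A \<phi> \<psi> \<longleftrightarrow>
     (\<exists>\<rho>. smooth_rack_action X rack one A \<rho> \<and>
       (\<forall>x y a. \<phi> x y a = \<rho> x a) \<and>
       (\<forall>x y a. \<psi> x y a = a - \<rho> (rack x y) a))"

definition smooth_antisymmetric_module ::
  "('x::topological_space, 'e::real_normed_vector) charted \<Rightarrow> ('x \<Rightarrow> 'x \<Rightarrow> 'x) \<Rightarrow> 'x \<Rightarrow>
   ('a::{ab_group_add, topological_space}, 'f::real_normed_vector) charted \<Rightarrow>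
   ('x \<Rightarrow> 'x \<Rightarrow> 'a \<Rightarrow> 'a) \<Rightarrow> ('x \<Rightarrow> 'x \<Rightarrow> 'a \<Rightarrow> 'a) \<Rightarrow> bool" where
  "smooth_antisymmetric_module X rack one A \<phi> \<psi> \<longleftrightarrow>
     (\<exists>\<rho>. smooth_rack_action X rack one A \<rho> \<and>
       (\<forall>x y a. \<phi> x y a = \<rho> x a) \<and>
       (\<forall>x y a. \<psi> x y a = 0))"

text \<open>
  The map \<open>(x, y) \<mapsto> T\<^sub>0\<alpha>\<^sub>x\<^sub>,\<^sub>y\<close> into \<open>End(T\<^sub>0A)\<close>: it is \<open>\<epsilon>\<close> for \<open>\<alpha> = \<phi>\<close> and \<open>\<chi>\<close> for \<open>\<alpha> = \<psi>\<close>.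
  Viewing \<open>\<epsilon>\<close> as a map into \<open>End\<close> does not change its tangent map, as \<open>Aut\<close> is open in \<open>End\<close>.
\<close>

definition linearization ::
  "('a::zero, 'f::real_normed_vector) charted \<Rightarrow> ('x \<Rightarrow> 'x \<Rightarrow> 'a \<Rightarrow> 'a) \<Rightarrow>
   'x \<times> 'x \<Rightarrow> 'f \<Rightarrow>\<^sub>L 'f" where
  "linearization A \<alpha> = (\<lambda>(x, y). tangent_map A A (\<alpha> x y) 0)"

definition induced_left ::
  "('x, 'e::real_normed_vector) charted \<Rightarrow> 'x \<Rightarrow> ('a::zero, 'f::real_normed_vector) charted \<Rightarrow>
   ('x \<Rightarrow> 'x \<Rightarrow> 'a \<Rightarrow> 'a) \<Rightarrow> 'e \<Rightarrow> 'f \<Rightarrow> 'f" where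
  "induced_left X one A \<phi> u m =
     blinfun_apply (blinfun_apply
       (tangent_map (X \<times>\<^sub>M X) vector_manifold (linearization A \<phi>) (one, one)) (u, 0)) m"

definition induced_right ::
  "('x, 'e::real_normed_vector) charted \<Rightarrow> 'x \<Rightarrow> ('a::zero, 'f::real_normed_vector) charted \<Rightarrow>
   ('x \<Rightarrow> 'x \<Rightarrow> 'a \<Rightarrow> 'a) \<Rightarrow> 'f \<Rightarrow> 'e \<Rightarrow> 'f" where
  "induced_right X one A \<psi> m u =
     blinfun_apply (blinfun_apply
       (tangent_map (X \<times>\<^sub>M X) vector_manifold (linearization A \<psi>) (one, one)) (0, u)) m"

section \<open>Leibniz algebras and their representations\<close>

locale leibniz_algebra =
  fixes br :: "'g::real_vector \<Rightarrow> 'g \<Rightarrow> 'g"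
  assumes bilinear_br: "bilinear br"
    and leibniz: "br x (br y z) = br (br x y) z + br y (br x z)"

locale leibniz_representation = leibniz_algebra br
  for br :: "'g::real_vector \<Rightarrow> 'g \<Rightarrow> 'g" +
  fixes L :: "'g \<Rightarrow> 'm::real_vector \<Rightarrow> 'm"
    and R :: "'m \<Rightarrow> 'g \<Rightarrow> 'm"
  assumes bilinear_L: "bilinear L"
    and bilinear_R: "bilinear R"
    and LLM: "L x (L y m) = L (br x y) m + L y (L x m)"
    and LML: "L x (R m y) = R (L x m) y + R m (br x y)"
    and MLL: "R m (br x y) = R (R m x) y + L x (R m y)"

locale symmetric_representation = leibniz_representation +
  assumes symmetric: "L x m = - R m x"

locale antisymmetric_representation = leibniz_representation +
  assumes antisymmetric: "R m x = 0"

end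

(* Write T x = T_0 (\<rho> x). Functoriality turns \<rho> (x |> y) \<rho> x = \<rho> x \<rho> y into
   T (x |> y) T x = T x T y, an identity of functions with values in a vector space. Differentiating
   first in y and then in x at the base point, where T and Ad are the identity, gives
   D [u,v] = D u D v - D v D u for the tangent map D of T. With Ad in place of T the same identity is
   the Leibniz rule. The remaining axioms follow, since the left action is D and the right action
   is -D (from the tangent map of a - \<rho> (x |> y) a and 1 |> y = y) or 0. *)

theory Submission
  imports Defs
begin

section \<open>Finite-dimensional model spaces and differentiability\<close>

text \<open>The difference of the two sides is orthogonal to every vector of the orthonormal family,
  so the totality axiom forces it to be 0.\<close>

lemma model_space_sum_basis:
  "\<exists>B :: 'e::model_space set. finite B \<and> (\<forall>x. (\<Sum>b\<in>B. inner x b *\<^sub>R b) = x)"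
proof -
  obtain B :: "'e set" where fin: "finite B"
    and orth: "\<And>u v. u \<in> B \<Longrightarrow> v \<in> B \<Longrightarrow> inner u v = (if u = v then 1 else 0)"
    and zero: "\<And>x. (\<forall>u\<in>B. inner x u = 0) \<longleftrightarrow> x = 0"
    using ex_orthonormal_basis by metis
  have "(\<Sum>b\<in>B. inner x b *\<^sub>R b) - x = 0" for x
  proof -
    have "inner ((\<Sum>b\<in>B. inner x b *\<^sub>R b) - x) u = 0" if "u \<in> B" for u
    proof -
      have "(\<Sum>b\<in>B. inner x b * inner b u) = (\<Sum>b\<in>B. if b = u then inner x b else 0)"
        using that by (intro sum.cong) (auto simp: orth)
      then show ?thesis
        using fin that by (simp add: inner_diff_left inner_sum_left)
    qed
    then show ?thesis using zero by blast
  qed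
  then show ?thesis using fin by auto
qed

text \<open>An operator on a finite-dimensional space is a finite sum built from its values on a
  basis, and each summand depends on such a value through a bounded linear map. Thus pointwise
  differentiability upgrades to the operator norm.\<close>

lemma differentiable_blinfun_componentwise:
  fixes L :: "'e::real_normed_vector \<Rightarrow> 'f::model_space \<Rightarrow>\<^sub>L 'g::real_normed_vector"
  assumes "\<And>v. (\<lambda>x. blinfun_apply (L x) v) differentiable F"
  shows "L differentiable F"
proof -
  obtain B :: "'f set" where B: "finite B" "\<And>x. (\<Sum>b\<in>B. inner x b *\<^sub>R b) = x"
    using model_space_sum_basis by blast
  \<comment> \<open>\<open>?E b w\<close> is the rank-one operator sending \<open>v\<close> to
    \<open>inner v b *\<^sub>R w\<close>.\<close>
  let ?E = "\<lambda>b (w::'g). blinfun_scaleR_left w o\<^sub>L blinfun_inner_left b"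
  have E: "bounded_linear (?E b)" for b
    by (rule bounded_linear_compose[OF
          bounded_bilinear.bounded_linear_left[OF bounded_bilinear_blinfun_compose]
          bounded_linear_blinfun_scaleR_left])
  have "L = (\<lambda>x. \<Sum>b\<in>B. ?E b (blinfun_apply (L x) b))"
  proof (rule ext, rule blinfun_eqI)
    fix x v
    have "blinfun_apply (L x) v = blinfun_apply (L x) (\<Sum>b\<in>B. inner v b *\<^sub>R b)"
      by (simp only: B(2))
    also have "\<dots> = blinfun_apply (\<Sum>b\<in>B. ?E b (blinfun_apply (L x) b)) v"
      by (simp add: blinfun.sum_right blinfun.scaleR_right blinfun.sum_left)
    finally show "blinfun_apply (L x) v = blinfun_apply (\<Sum>b\<in>B. ?E b (blinfun_apply (L x) b)) v" .
  qed
  moreover have "(\<lambda>x. \<Sum>b\<in>B. ?E b (blinfun_apply (L x) b)) differentiable F"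
  proof (rule differentiable_sum[OF B(1)], rule ballI)
    fix b
    obtain D where "((\<lambda>x. blinfun_apply (L x) b) has_derivative D) F"
      using assms[of b] by (auto simp: differentiable_def)
    from bounded_linear.has_derivative[OF E[of b] this]
    show "(\<lambda>x. ?E b (blinfun_apply (L x) b)) differentiable F"
      by (auto simp: differentiable_def)
  qed
  ultimately show ?thesis by simp
qed

lemma smooth_on_differentiable:
  assumes "smooth_on S f" "x \<in> S"
  shows "f differentiable (at x)"
    and "(\<lambda>x. frechet_derivative f (at x) v) differentiable (at x)"
proof -
  \<comment> \<open>Class \<open>C\<^sup>2\<close> is the first that makes the directional
    derivatives themselves differentiable.\<close>
  have "Ck_on (Suc (Suc 0)) S f"
    using assms by (simp add: smooth_on_def)
  then show "f differentiable (at x)" "(\<lambda>x. frechet_derivative f (at x) v) differentiable (at x)"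
    using assms(2) by (auto simp only: Ck_on.simps)
qed

section \<open>Tangent maps\<close>

text \<open>The part of \<open>smooth_manifold\<close> that concerns a single point. It suffices for
  computing tangent maps and passes to products without a check that product charts are
  compatible.\<close>

definition charted_at :: "('x::topological_space, 'e::real_normed_vector) charted \<Rightarrow> 'x \<Rightarrow> bool" where
  "charted_at M p \<longleftrightarrow>
     chart_at M p \<in> atlas M \<and> is_chart (chart_at M p) \<and> p \<in> fst (chart_at M p)"

text \<open>Unlike the total function \<open>tangent_map\<close>, this relation also asserts that
  the derivative exists. Continuity is included because the target coordinate map is arbitrary off
  its domain: it guarantees that points near \<open>p\<close> land in that domain.\<close>

definition has_tangent_map ::
  "('x::t2_space, 'e::real_normed_vector) charted \<Rightarrow>
   ('y::topological_space, 'f::real_normed_vector) charted \<Rightarrow>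
   ('x \<Rightarrow> 'y) \<Rightarrow> 'x \<Rightarrow> ('e \<Rightarrow> 'f) \<Rightarrow> bool" where
  "has_tangent_map M N f p D \<longleftrightarrow> isCont f p \<and>
     (in_charts (chart_at M p) (chart_at N (f p)) f has_derivative D) (at (snd (chart_at M p) p))"

lemma (in smooth_manifold) charted_at: "charted_at M p"
  by (simp add: charted_at_def chart_at_in_atlas is_chart in_chart_at)

lemma chart_inv_left:
  "is_chart c \<Longrightarrow> p \<in> fst c \<Longrightarrow> chart_inv c (snd c p) = p"
  by (auto simp: is_chart_def homeomorphism_def)

lemma chart_inv_right:
  "e \<in> snd c ` fst c \<Longrightarrow> snd c (chart_inv c e) = e"
  by (auto simp: chart_inv_def f_inv_into_f)

lemma chart_inv_in:
  "e \<in> snd c ` fst c \<Longrightarrow> chart_inv c e \<in> fst c"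
  by (auto simp: chart_inv_def inv_into_into)

lemma isCont_chart_inv:
  "is_chart c \<Longrightarrow> e \<in> snd c ` fst c \<Longrightarrow> isCont (chart_inv c) e"
  unfolding is_chart_def homeomorphism_def by (metis continuous_on_eq_continuous_at)

lemma isCont_chart:
  "is_chart c \<Longrightarrow> p \<in> fst c \<Longrightarrow> isCont (snd c) p"
  for c :: "('x::t2_space, 'e::real_normed_vector) chart"
  unfolding is_chart_def homeomorphism_def by (metis continuous_on_eq_continuous_at)

text \<open>Carries a local property at \<open>p\<close> into coordinates. Even for the trivially
  true \<open>P\<close> it yields that coordinates near \<open>snd c p\<close> lie in the chart
  image, where \<open>chart_inv\<close> is a genuine inverse.\<close>

lemma eventually_chart_inv:
  assumes "is_chart c" "p \<in> fst c" and "eventually P (nhds p)"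
  shows "eventually (\<lambda>e. e \<in> snd c ` fst c \<and> P (chart_inv c e)) (nhds (snd c p))"
proof (rule eventually_conj)
  show "\<forall>\<^sub>F e in nhds (snd c p). e \<in> snd c ` fst c"
    using assms by (auto simp: is_chart_def intro!: eventually_nhds_in_open)
  have "filterlim (chart_inv c) (nhds p) (nhds (snd c p))"
    using isCont_chart_inv[OF assms(1) imageI[OF assms(2)]]
    unfolding isCont_def tendsto_at_iff_tendsto_nhds by (simp add: chart_inv_left assms)
  then show "\<forall>\<^sub>F e in nhds (snd c p). P (chart_inv c e)"
    using assms(3) by (rule eventually_compose_filterlim[rotated])
qed

lemma has_derivative_transform_nhds:
  assumes "(f has_derivative D) (at x)" "eventually (\<lambda>x. f x = g x) (nhds x)"
  shows "(g has_derivative D) (at x)"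
  using assms by (auto simp: eventually_nhds intro: has_derivative_transform_within_open)

text \<open>Uniqueness of the Frechet derivative identifies the chosen derivative with
  \<open>D\<close>, and since \<open>D\<close> is bounded linear, \<open>Blinfun\<close> loses
  nothing.\<close>

lemma tangent_map_eq:
  "has_tangent_map M N f p D \<Longrightarrow> blinfun_apply (tangent_map M N f p) = D"
  unfolding has_tangent_map_def tangent_map_def
  by (metis bounded_linear_Blinfun_apply frechet_derivative_at has_derivative_bounded_linear)

lemma has_tangent_map_unique:
  "has_tangent_map M N f p D \<Longrightarrow> has_tangent_map M N f p E \<Longrightarrow> D = E"
  unfolding has_tangent_map_def by (metis has_derivative_unique)

lemma has_tangent_map_compose:
  fixes M :: "('x::t2_space, 'e::real_normed_vector) charted"
    and N :: "('y::t2_space, 'f::real_normed_vector) charted"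
    and P :: "('z::t2_space, 'g::real_normed_vector) charted"
  assumes M: "charted_at M p" and N: "charted_at N (f p)"
    and f: "has_tangent_map M N f p D" and g: "has_tangent_map N P g (f p) E"
  shows "has_tangent_map M P (\<lambda>x. g (f x)) p (\<lambda>v. E (D v))"
  unfolding has_tangent_map_def
proof
  let ?c = "chart_at M p" and ?d = "chart_at N (f p)" and ?k = "chart_at P (g (f p))"
  show "isCont (\<lambda>x. g (f x)) p"
    using f g by (auto simp: has_tangent_map_def intro: isCont_o2)
  have c: "is_chart ?c" "p \<in> fst ?c" and d: "is_chart ?d" "f p \<in> fst ?d"
    using M N by (auto simp: charted_at_def)
  have "filterlim f (nhds (f p)) (nhds p)"
    using f by (simp add: has_tangent_map_def isCont_def tendsto_at_iff_tendsto_nhds)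
  moreover have "\<forall>\<^sub>F y in nhds (f p). y \<in> fst ?d"
    using d by (auto simp: is_chart_def intro: eventually_nhds_in_open)
  ultimately have "\<forall>\<^sub>F x in nhds p. f x \<in> fst ?d"
    by (rule eventually_compose_filterlim[rotated])
  \<comment> \<open>The middle chart cancels only where \<open>f x\<close> lies in its domain, so
    the two coordinate expressions agree merely near the point.\<close>
  then have ev: "\<forall>\<^sub>F e in nhds (snd ?c p). in_charts ?d ?k g (in_charts ?c ?d f e)
      = in_charts ?c ?k (\<lambda>x. g (f x)) e"
    by (rule eventually_mono[OF eventually_chart_inv[OF c]])
      (simp add: in_charts_def chart_inv_left[OF d(1)])
  have "in_charts ?c ?d f (snd ?c p) = snd ?d (f p)"
    by (simp add: in_charts_def chart_inv_left[OF c])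
  then have "((\<lambda>e. in_charts ?d ?k g (in_charts ?c ?d f e)) has_derivative (\<lambda>v. E (D v)))
      (at (snd ?c p))"
    using f g by (intro has_derivative_compose[of _ D _ _ _ E]) (auto simp: has_tangent_map_def)
  then show "(in_charts ?c ?k (\<lambda>x. g (f x)) has_derivative (\<lambda>v. E (D v))) (at (snd ?c p))"
    using ev by (rule has_derivative_transform_nhds)
qed

lemma has_tangent_map_const:
  "has_tangent_map M N (\<lambda>_. q) p (\<lambda>_. 0)"
  by (simp add: has_tangent_map_def in_charts_def comp_def)

lemma has_tangent_map_ident:
  assumes "charted_at M p"
  shows "has_tangent_map M M (\<lambda>x. x) p (\<lambda>v. v)"
  unfolding has_tangent_map_def
proof
  have c: "is_chart (chart_at M p)" "p \<in> fst (chart_at M p)"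
    using assms by (auto simp: charted_at_def)
  have "\<forall>\<^sub>F e in nhds (snd (chart_at M p) p).
      e = in_charts (chart_at M p) (chart_at M p) (\<lambda>x. x) e"
    by (rule eventually_mono[OF eventually_chart_inv[OF c, of "\<lambda>_. True"]])
      (auto simp: in_charts_def chart_inv_right)
  then show "(in_charts (chart_at M p) (chart_at M p) (\<lambda>x. x) has_derivative (\<lambda>v. v))
      (at (snd (chart_at M p) p))"
    by (rule has_derivative_transform_nhds[OF has_derivative_ident])
qed simp

lemma has_tangent_map_Pair:
  assumes "has_tangent_map M N f p D" "has_tangent_map M N' g p E"
  shows "has_tangent_map M (N \<times>\<^sub>M N') (\<lambda>x. (f x, g x)) p (\<lambda>v. (D v, E v))"
proof -
  let ?c = "chart_at M p"
  have "in_charts ?c (chart_at (N \<times>\<^sub>M N') (f p, g p)) (\<lambda>x. (f x, g x)) =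
      (\<lambda>e. (in_charts ?c (chart_at N (f p)) f e, in_charts ?c (chart_at N' (g p)) g e))"
    by (auto simp: in_charts_def prod_manifold_def)
  then show ?thesis
    using assms by (auto simp: has_tangent_map_def intro: has_derivative_Pair isCont_Pair)
qed

section \<open>Product charts and the first projection\<close>

text \<open>On the image, injectivity of the product coordinate map determines
  \<open>inv_into\<close>; outside it the value is arbitrary.\<close>

lemma chart_inv_prod:
  assumes "is_chart c" "is_chart d" "e \<in> snd c ` fst c" "e' \<in> snd d ` fst d"
  shows "chart_inv (fst c \<times> fst d, map_prod (snd c) (snd d)) (e, e') = (chart_inv c e, chart_inv d e')"
proof -
  have "inj_on (snd c) (fst c)" "inj_on (snd d) (fst d)"
    using assms(1,2) by (metis chart_inv_left inj_onI)+
  then have "inj_on (map_prod (snd c) (snd d)) (fst c \<times> fst d)"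
    by (rule map_prod_inj_on)
  then show ?thesis
    unfolding chart_inv_def[of "(_, _)"]
    using assms(3,4)
    by (auto simp: chart_inv_left[OF assms(1)] chart_inv_left[OF assms(2)] intro!: inv_into_f_eq)
qed

lemma is_chart_prod:
  assumes "is_chart c" "is_chart d"
  shows "is_chart (fst c \<times> fst d, map_prod (snd c) (snd d))"
proof -
  let ?S = "snd c ` fst c" and ?T = "snd d ` fst d"
  have img: "map_prod (snd c) (snd d) ` (fst c \<times> fst d) = ?S \<times> ?T"
    by (rule map_prod_surj_on) auto
  have ci: "continuous_on ?S (chart_inv c)" "continuous_on ?T (chart_inv d)"
    and cc: "continuous_on (fst c) (snd c)" "continuous_on (fst d) (snd d)"
    using assms by (auto simp: is_chart_def homeomorphism_def)
  have "continuous_on (?S \<times> ?T) (chart_inv (fst c \<times> fst d, map_prod (snd c) (snd d)))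
      = continuous_on (?S \<times> ?T) (\<lambda>z. (chart_inv c (fst z), chart_inv d (snd z)))"
    by (rule continuous_on_cong) (auto simp: chart_inv_prod[OF assms])
  also have "\<dots>"
    by (intro continuous_on_Pair continuous_on_compose2[OF ci(1)] continuous_on_compose2[OF ci(2)]
        continuous_intros) auto
  finally have 1: "continuous_on (?S \<times> ?T) (chart_inv (fst c \<times> fst d, map_prod (snd c) (snd d)))" .
  have 2: "continuous_on (fst c \<times> fst d) (map_prod (snd c) (snd d))"
    unfolding map_prod_def case_prod_beta
    by (intro continuous_on_Pair continuous_on_compose2[OF cc(1)] continuous_on_compose2[OF cc(2)]
        continuous_intros) auto
  have "homeomorphism (fst c \<times> fst d) (?S \<times> ?T) (map_prod (snd c) (snd d))
      (chart_inv (fst c \<times> fst d, map_prod (snd c) (snd d)))"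
    by (rule homeomorphismI[OF 2 1])
      (auto simp: chart_inv_prod[OF assms] chart_inv_left[OF assms(1)] chart_inv_left[OF assms(2)]
        chart_inv_in chart_inv_right)
  then show ?thesis
    using assms unfolding is_chart_def fst_conv snd_conv img by (simp add: open_Times)
qed

lemma charted_at_prod:
  assumes "charted_at M p" "charted_at N q"
  shows "charted_at (M \<times>\<^sub>M N) (p, q)"
  unfolding charted_at_def
proof (intro conjI)
  show "chart_at (M \<times>\<^sub>M N) (p, q) \<in> atlas (M \<times>\<^sub>M N)"
    unfolding prod_manifold_def charted.simps prod.case mem_Collect_eq
    by (intro exI[of _ "chart_at M p"] exI[of _ "chart_at N q"])
      (use assms in \<open>simp add: charted_at_def\<close>)
qed (use assms in \<open>simp_all add: charted_at_def prod_manifold_def is_chart_prod\<close>)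

text \<open>On the image of the product chart the coordinate expression of the projection is again
  \<open>fst\<close>, which is linear.\<close>

lemma has_tangent_map_fst:
  assumes M: "charted_at M p" and N: "charted_at N q"
  shows "has_tangent_map (M \<times>\<^sub>M N) M fst (p, q) fst"
  unfolding has_tangent_map_def
proof
  let ?c = "chart_at M p" and ?d = "chart_at N q" and ?k = "chart_at (M \<times>\<^sub>M N) (p, q)"
  have c: "is_chart ?c" "p \<in> fst ?c" and d: "is_chart ?d" "q \<in> fst ?d"
    and k: "is_chart ?k" "(p, q) \<in> fst ?k"
    using M N charted_at_prod[OF M N] by (auto simp: charted_at_def)
  have k_eq: "?k = (fst ?c \<times> fst ?d, map_prod (snd ?c) (snd ?d))"
    by (simp add: prod_manifold_def)
  have "fst e = in_charts ?k ?c fst e" if "e \<in> snd ?k ` fst ?k" for e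
  proof -
    have "fst e \<in> snd ?c ` fst ?c" "snd e \<in> snd ?d ` fst ?d"
      using that unfolding k_eq by auto
    with chart_inv_prod[OF c(1) d(1) this] show ?thesis
      unfolding k_eq in_charts_def by (simp add: chart_inv_right)
  qed
  then have "\<forall>\<^sub>F e in nhds (snd ?k (p, q)). fst e = in_charts ?k ?c fst e"
    by (intro eventually_mono[OF eventually_chart_inv[OF k, of "\<lambda>_. True"]]) auto
  then show "(in_charts ?k (chart_at M (fst (p, q))) fst has_derivative fst) (at (snd ?k (p, q)))"
    unfolding fst_conv
    by (rule has_derivative_transform_nhds[OF has_derivative_fst[OF has_derivative_ident]])
qed simp

section \<open>Tangent maps of smooth maps\<close>

lemma smooth_on_in_charts_at:
  assumes "smooth_map M N f" "charted_at M p" "charted_at N (f p)"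
  shows "smooth_on (snd (chart_at M p) ` (fst (chart_at M p) \<inter> f -` fst (chart_at N (f p))))
    (in_charts (chart_at M p) (chart_at N (f p)) f)"
  using assms by (auto simp: smooth_map_def charted_at_def)

lemma smooth_map_isCont:
  "smooth_map M N f \<Longrightarrow> isCont f p"
  by (simp add: smooth_map_def continuous_on_eq_continuous_at)

lemma smooth_map_has_tangent_map:
  assumes "smooth_map M N f" "charted_at M p" "charted_at N (f p)"
  shows "has_tangent_map M N f p (blinfun_apply (tangent_map M N f p))"
proof -
  have "in_charts (chart_at M p) (chart_at N (f p)) f differentiable (at (snd (chart_at M p) p))"
    using assms(2,3)
    by (intro smooth_on_differentiable(1)[OF smooth_on_in_charts_at[OF assms]])
      (auto simp: charted_at_def)
  then obtain D where "has_tangent_map M N f p D"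
    using smooth_map_isCont[OF assms(1)] by (auto simp: has_tangent_map_def differentiable_def)
  then show ?thesis by (simp add: tangent_map_eq)
qed

section \<open>Calculus of vector-valued maps on a manifold\<close>

lemma in_charts_vector_manifold:
  "in_charts c (chart_at vector_manifold w) f = (\<lambda>e. f (chart_inv c e))"
  by (simp add: in_charts_def vector_manifold_def comp_def)

text \<open>A vector space has a global chart, so the continuity clause comes for free: the
  derivative gives continuity in coordinates, and composing with the chart of \<open>M\<close>
  brings it back to the manifold.\<close>

lemma has_tangent_map_vectorI:
  fixes f :: "'x::t2_space \<Rightarrow> 'w::real_normed_vector"
  assumes "charted_at M p"
    and D: "((\<lambda>e. f (chart_inv (chart_at M p) e)) has_derivative D) (at (snd (chart_at M p) p))"
  shows "has_tangent_map M vector_manifold f p D"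
  unfolding has_tangent_map_def in_charts_vector_manifold
proof
  let ?c = "chart_at M p"
  have c: "is_chart ?c" "p \<in> fst ?c" "open (fst ?c)"
    using assms by (auto simp: charted_at_def is_chart_def)
  have "isCont (\<lambda>x. f (chart_inv ?c (snd ?c x))) p"
    using isCont_o2[OF isCont_chart[OF c(1,2)] has_derivative_continuous[OF D]] by simp
  moreover have ev: "\<forall>\<^sub>F x in nhds p. f (chart_inv ?c (snd ?c x)) = f x"
    using eventually_nhds_in_open[OF c(3,2)]
    by (rule eventually_mono) (simp add: chart_inv_left[OF c(1)])
  ultimately show "isCont f p"
    using isCont_cong[OF ev] by simp
qed (fact D)

lemma has_tangent_map_vectorD:
  "has_tangent_map M vector_manifold f p D \<Longrightarrow>
    ((\<lambda>e. f (chart_inv (chart_at M p) e)) has_derivative D) (at (snd (chart_at M p) p))"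
  by (simp add: has_tangent_map_def in_charts_vector_manifold)

text \<open>The product rule; it is applied below to composition of operators.\<close>

lemma has_tangent_map_bilinear:
  fixes f :: "'x::t2_space \<Rightarrow> 'u::real_normed_vector" and g :: "'x \<Rightarrow> 'v::real_normed_vector"
  assumes "bounded_bilinear pr" and M: "charted_at M p"
    and f: "has_tangent_map M vector_manifold f p D" and g: "has_tangent_map M vector_manifold g p E"
  shows "has_tangent_map M vector_manifold (\<lambda>x. pr (f x) (g x)) p
    (\<lambda>u. pr (f p) (E u) + pr (D u) (g p))"
proof -
  have "chart_inv (chart_at M p) (snd (chart_at M p) p) = p"
    using M by (auto simp: charted_at_def chart_inv_left)
  then show ?thesis
    using bounded_bilinear.FDERIV[OF assms(1) has_tangent_map_vectorD[OF f] has_tangent_map_vectorD[OF g]]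
    by (intro has_tangent_map_vectorI[OF M]) simp
qed

lemma has_tangent_map_linear:
  fixes f :: "'x::t2_space \<Rightarrow> 'u::real_normed_vector"
  assumes "bounded_linear l" and "charted_at M p"
    and "has_tangent_map M vector_manifold f p D"
  shows "has_tangent_map M vector_manifold (\<lambda>x. l (f x)) p (\<lambda>u. l (D u))"
  by (rule has_tangent_map_vectorI[OF assms(2) bounded_linear.has_derivative[OF assms(1)
        has_tangent_map_vectorD[OF assms(3)]]])


text \<open>
  The partial derivative of \<open>h\<close> in the second variable, taken along the fixed section \<open>q\<close>, depends
  differentiably on the first variable; this is the only use of second derivatives. Finite
  dimension of the model space of \<open>N\<close> turns pointwise differentiability into differentiability in
  the operator norm.
\<close>

lemma tangent_map_family:
  fixes M :: "('x::t2_space, 'e::real_normed_vector) charted"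
    and N :: "('y::t2_space, 'f::model_space) charted"
  assumes smooth: "smooth_map (M \<times>\<^sub>M N) N (\<lambda>(x, q). h x q)"
    and M: "charted_at M p" and N: "charted_at N q" and fixed: "\<And>x. h x q = q"
  defines "T \<equiv> \<lambda>x. tangent_map N N (h x) q"
  shows "has_tangent_map M vector_manifold T p (blinfun_apply (tangent_map M vector_manifold T p))"
proof -
  let ?c = "chart_at M p" and ?d = "chart_at N q" and ?k = "chart_at (M \<times>\<^sub>M N) (p, q)"
  let ?q = "snd ?d q"
  define F where "F = in_charts ?k ?d (\<lambda>(x, q). h x q)"
  define S where "S = snd ?k ` (fst ?k \<inter> (\<lambda>(x, q). h x q) -` fst ?d)"
  have c: "is_chart ?c" "p \<in> fst ?c" and d: "is_chart ?d" "q \<in> fst ?d"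
    using M N by (auto simp: charted_at_def)
  have F: "smooth_on S F"
    using smooth_on_in_charts_at[OF smooth charted_at_prod[OF M N]] N by (simp add: fixed F_def S_def)
  \<comment> \<open>Since every \<open>h x\<close> fixes \<open>q\<close>, the whole slice through
    \<open>q\<close> stays in the set where \<open>F\<close> is smooth.\<close>
  have S: "(snd ?c x, ?q) \<in> S" if "x \<in> fst ?c" for x
    using that d unfolding S_def by (force simp: prod_manifold_def fixed)
  \<comment> \<open>The tangent map of \<open>h x\<close> at \<open>q\<close> is the partial
    derivative of \<open>F\<close> in its second slot, by the chain rule along the inclusion of the
    slice with first coordinate \<open>snd ?c x\<close>.\<close>
  have T: "blinfun_apply (T x) v = frechet_derivative F (at (snd ?c x, ?q)) (0, v)"
    if x: "x \<in> fst ?c" for x v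
  proof -
    let ?D = "frechet_derivative F (at (snd ?c x, ?q))"
    have "(F has_derivative ?D) (at (snd ?c x, ?q))"
      using smooth_on_differentiable(1)[OF F S[OF x]] by (simp add: frechet_derivative_works)
    then have "((\<lambda>e. F (snd ?c x, e)) has_derivative (\<lambda>v. ?D (0, v))) (at ?q)"
      by (rule has_derivative_compose[rotated]) (intro derivative_intros)
    moreover have "F (snd ?c x, e) = in_charts ?d ?d (h x) e" if "e \<in> snd ?d ` fst ?d" for e
      using chart_inv_prod[OF c(1) d(1) _ that, of "snd ?c x"] x
      by (simp add: F_def in_charts_def prod_manifold_def chart_inv_left[OF c(1)])
    then have "\<forall>\<^sub>F e in nhds ?q. F (snd ?c x, e) = in_charts ?d ?d (h x) e"
      by (intro eventually_mono[OF eventually_chart_inv[OF d, of "\<lambda>_. True"]]) auto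
    ultimately have "(in_charts ?d ?d (h x) has_derivative (\<lambda>v. ?D (0, v))) (at ?q)"
      by (rule has_derivative_transform_nhds)
    then show ?thesis
      unfolding T_def tangent_map_def fixed
      by (metis bounded_linear_Blinfun_apply frechet_derivative_at has_derivative_bounded_linear)
  qed
  \<comment> \<open>For fixed \<open>v\<close> this is a directional derivative of \<open>F\<close>,
    differentiable in both slots, restricted to second coordinate \<open>?q\<close>.\<close>
  have "(\<lambda>e. blinfun_apply (T (chart_inv ?c e)) v) differentiable (at (snd ?c p))" for v
  proof -
    obtain D where "((\<lambda>z. frechet_derivative F (at z) (0, v)) has_derivative D) (at (snd ?c p, ?q))"
      using smooth_on_differentiable(2)[OF F S[OF c(2)]] by (auto simp: differentiable_def)
    then have "((\<lambda>e. frechet_derivative F (at (e, ?q)) (0, v)) has_derivative (\<lambda>u. D (u, 0)))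
        (at (snd ?c p))"
      by (rule has_derivative_compose[rotated]) (intro derivative_intros)
    moreover have "frechet_derivative F (at (e, ?q)) (0, v) = blinfun_apply (T (chart_inv ?c e)) v"
      if "e \<in> snd ?c ` fst ?c" for e
      using T[OF chart_inv_in[OF that]] by (simp add: chart_inv_right[OF that])
    then have "\<forall>\<^sub>F e in nhds (snd ?c p).
        frechet_derivative F (at (e, ?q)) (0, v) = blinfun_apply (T (chart_inv ?c e)) v"
      by (intro eventually_mono[OF eventually_chart_inv[OF c, of "\<lambda>_. True"]]) auto
    ultimately show ?thesis
      unfolding differentiable_def by (blast intro: has_derivative_transform_nhds)
  qed
  then have "(\<lambda>e. T (chart_inv ?c e)) differentiable (at (snd ?c p))"
    by (rule differentiable_blinfun_componentwise)
  then obtain D where "has_tangent_map M vector_manifold T p D"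
    unfolding differentiable_def using has_tangent_map_vectorI[OF M] by blast
  then show ?thesis by (simp add: tangent_map_eq)
qed

lemma tangent_map_eqI:
  assumes "has_tangent_map M N f p (blinfun_apply D)"
  shows "tangent_map M N f p = D"
  using tangent_map_eq[OF assms] by (simp add: blinfun_apply_inject)

lemma tangent_map_ident:
  "charted_at M p \<Longrightarrow> tangent_map M M (\<lambda>x. x) p = id_blinfun"
  for M :: "('x::t2_space, 'e::real_normed_vector) charted"
  by (rule tangent_map_eqI) (simp add: has_tangent_map_ident id_blinfun.rep_eq)

lemma tangent_map_compose:
  fixes M :: "('x::t2_space, 'e::real_normed_vector) charted"
    and N :: "('y::t2_space, 'f::real_normed_vector) charted"
    and P :: "('z::t2_space, 'g::real_normed_vector) charted"
  assumes "smooth_map M N f" "smooth_map N P g"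
    and "charted_at M p" "charted_at N (f p)" "charted_at P (g (f p))"
  shows "tangent_map M P (\<lambda>x. g (f x)) p = tangent_map N P g (f p) o\<^sub>L tangent_map M N f p"
proof (rule tangent_map_eqI)
  have "has_tangent_map M P (\<lambda>x. g (f x)) p
      (\<lambda>v. blinfun_apply (tangent_map N P g (f p)) (blinfun_apply (tangent_map M N f p) v))"
    by (rule has_tangent_map_compose[OF assms(3,4) smooth_map_has_tangent_map[OF assms(1,3,4)]
          smooth_map_has_tangent_map[OF assms(2,4,5)]])
  then show "has_tangent_map M P (\<lambda>x. g (f x)) p
      (blinfun_apply (tangent_map N P g (f p) o\<^sub>L tangent_map M N f p))"
    by (simp add: blinfun_compose.rep_eq comp_def)
qed

lemma blinfun_compose_id: "D o\<^sub>L id_blinfun = D"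
  by (rule blinfun_eqI) simp

section \<open>Lie racks\<close>

context lie_rack
begin

lemma smooth_rack_left: "smooth_map X X (\<lambda>y. x \<rhd> y)"
  using diffeo by (simp add: diffeomorphism_def)

lemma has_tangent_map_rack_left:
  "has_tangent_map X X (\<lambda>y. x \<rhd> y) \<one> (blinfun_apply (rack_Ad X rack \<one> x))"
  unfolding rack_Ad_def
  by (rule smooth_map_has_tangent_map[OF smooth_rack_left charted_at charted_at])

lemma rack_Ad_one: "rack_Ad X rack \<one> \<one> = id_blinfun"
proof -
  have "(\<rhd>) \<one> = (\<lambda>x. x)"
    using one_left by auto
  then show ?thesis
    by (simp add: rack_Ad_def tangent_map_ident[OF charted_at])
qed

text \<open>The family here is the rack product itself: the axiom
  \<open>x \<rhd> \<one> = \<one>\<close> says that all its members fix the base point.\<close>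

lemma has_tangent_map_rack_Ad:
  "has_tangent_map X vector_manifold (rack_Ad X rack \<one>) \<one> (blinfun_apply (rack_ad X rack \<one>))"
  unfolding rack_ad_def rack_Ad_def
  by (rule tangent_map_family[OF smooth_rack charted_at charted_at one_right])

text \<open>Self-distributivity says that left multiplication by \<open>x \<rhd> y\<close> after
  that by \<open>x\<close> equals left multiplication by \<open>x\<close> after that by
  \<open>y\<close>. All of these fix \<open>\<one>\<close>, so functoriality turns the identity into
  one of operators.\<close>

lemma rack_Ad_rack:
  "rack_Ad X rack \<one> (x \<rhd> y) o\<^sub>L rack_Ad X rack \<one> x =
   rack_Ad X rack \<one> x o\<^sub>L rack_Ad X rack \<one> y"
proof -
  have "tangent_map X X (\<lambda>z. (x \<rhd> y) \<rhd> (x \<rhd> z)) \<one> = tangent_map X X (\<lambda>z. x \<rhd> (y \<rhd> z)) \<one>"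
    by (simp flip: self_distrib)
  then show ?thesis
    by (simp add: tangent_map_compose[where N = X] smooth_rack_left charted_at one_right rack_Ad_def)
qed

text \<open>Stated for a general operator family because it serves twice: for the adjoint action it
  yields the Leibniz identity, for a linearised module action the representation axioms.\<close>

lemma tangent_equivariant_action:
  fixes T :: "'x \<Rightarrow> 'f::real_normed_vector \<Rightarrow>\<^sub>L 'f"
  assumes T: "has_tangent_map X vector_manifold T \<one> D"
    and one: "T \<one> = id_blinfun"
    and act: "\<And>x y. T (x \<rhd> y) o\<^sub>L T x = T x o\<^sub>L T y"
  shows "D (rack_bracket X rack \<one> u v) = (D u o\<^sub>L D v) - (D v o\<^sub>L D u)"
proof -
  have bl: "bounded_linear D"
    using has_tangent_map_vectorD[OF T] by (rule has_derivative_bounded_linear)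
  \<comment> \<open>The derivative of \<open>act\<close> in \<open>y\<close> at \<open>\<one>\<close>; below it is differentiated once more, in \<open>x\<close>.\<close>
  have first: "D (rack_Ad X rack \<one> x v) o\<^sub>L T x = T x o\<^sub>L D v" for x v
  proof -
    \<comment> \<open>Left multiplication by \<open>x\<close> fixes \<open>\<one>\<close>, so the
      chain rule uses the derivative of \<open>T\<close> at \<open>\<one>\<close> again.\<close>
    have "has_tangent_map X vector_manifold (\<lambda>y. T (x \<rhd> y)) \<one> (\<lambda>v. D (rack_Ad X rack \<one> x v))"
      by (rule has_tangent_map_compose[OF charted_at charted_at has_tangent_map_rack_left])
        (simp add: one_right T)
    from has_tangent_map_linear[OF bounded_bilinear.bounded_linear_left[OF
          bounded_bilinear_blinfun_compose, of "T x"] charted_at this]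
    have "has_tangent_map X vector_manifold (\<lambda>y. T x o\<^sub>L T y) \<one>
        (\<lambda>v. D (rack_Ad X rack \<one> x v) o\<^sub>L T x)"
      by (simp add: act)
    moreover have "has_tangent_map X vector_manifold (\<lambda>y. T x o\<^sub>L T y) \<one> (\<lambda>v. T x o\<^sub>L D v)"
      by (rule has_tangent_map_linear[OF bounded_bilinear.bounded_linear_right[OF
          bounded_bilinear_blinfun_compose] charted_at T])
    ultimately show ?thesis by (metis has_tangent_map_unique)
  qed
  \<comment> \<open>Both \<open>D\<close> and evaluation at \<open>v\<close> are bounded linear, so
    the derivative passes through them and turns \<open>rack_Ad\<close> into
    \<open>rack_ad\<close>.\<close>
  have "has_tangent_map X vector_manifold (\<lambda>x. D (rack_Ad X rack \<one> x v)) \<one>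
      (\<lambda>u. D (rack_bracket X rack \<one> u v))"
    unfolding rack_bracket_def
    by (rule has_tangent_map_linear[OF bounded_linear_compose[OF bl blinfun.bounded_linear_left]
          charted_at has_tangent_map_rack_Ad])
  \<comment> \<open>The product rule on the left side of \<open>first\<close>. At
    \<open>\<one>\<close> both \<open>T\<close> and \<open>rack_Ad\<close> are the identity, so the
    factors there are \<open>D v\<close> and \<open>id_blinfun\<close>.\<close>
  from has_tangent_map_bilinear[OF bounded_bilinear_blinfun_compose charted_at this T]
  have "has_tangent_map X vector_manifold (\<lambda>x. T x o\<^sub>L D v) \<one>
      (\<lambda>u. (D v o\<^sub>L D u) + D (rack_bracket X rack \<one> u v))"
    by (simp add: first one rack_Ad_one blinfun_compose_id)
  moreover have "has_tangent_map X vector_manifold (\<lambda>x. T x o\<^sub>L D v) \<one> (\<lambda>u. D u o\<^sub>L D v)"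
    by (rule has_tangent_map_linear[OF bounded_bilinear.bounded_linear_left[OF
          bounded_bilinear_blinfun_compose] charted_at T])
  ultimately have "(\<lambda>u. (D v o\<^sub>L D u) + D (rack_bracket X rack \<one> u v)) = (\<lambda>u. D u o\<^sub>L D v)"
    by (rule has_tangent_map_unique)
  then have "(D v o\<^sub>L D u) + D (rack_bracket X rack \<one> u v) = D u o\<^sub>L D v"
    by meson
  then show ?thesis by (simp add: algebra_simps)
qed

lemma leibniz_algebra_rack_bracket: "leibniz_algebra (rack_bracket X rack \<one>)"
proof
  show "bilinear (rack_bracket X rack \<one>)"
    unfolding rack_bracket_def bilinear_def
    by (simp add: linear_iff blinfun.add_left blinfun.add_right blinfun.scaleR_left blinfun.scaleR_right)
  show "rack_bracket X rack \<one> x (rack_bracket X rack \<one> y z) =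
      rack_bracket X rack \<one> (rack_bracket X rack \<one> x y) z +
      rack_bracket X rack \<one> y (rack_bracket X rack \<one> x z)" for x y z
    \<comment> \<open>With \<open>T\<close> the adjoint action, the commutator identity evaluated at
      \<open>z\<close> is the Leibniz rule. Only the brackets acting on \<open>z\<close> are
      unfolded, so the bracket of \<open>x\<close> and \<open>y\<close> keeps the form it has in
      that identity.\<close>
    using tangent_equivariant_action[OF has_tangent_map_rack_Ad rack_Ad_one rack_Ad_rack, of x y]
    by (simp add: rack_bracket_def[of X rack \<one> _ z] rack_bracket_def[of X rack \<one> _ "blinfun_apply _ z"] blinfun.diff_left)
qed

end

section \<open>Abelian Lie groups and rack actions\<close>

context abelian_lie_group
begin

text \<open>By linearity the tangent map is determined on the two axes, where
  \<open>a + 0 = a\<close> and \<open>0 + a = a\<close> make it the identity.\<close>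

lemma tangent_add:
  "has_tangent_map (A \<times>\<^sub>M A) A (\<lambda>(a, b). a + b) (0, 0) (\<lambda>(u, v). u + v)"
proof -
  let ?D = "blinfun_apply (tangent_map (A \<times>\<^sub>M A) A (\<lambda>(a, b). a + b) (0, 0))"
  note pair = charted_at_prod[OF charted_at charted_at]
  note ident = has_tangent_map_ident[OF charted_at]
  have D: "has_tangent_map (A \<times>\<^sub>M A) A (\<lambda>(a, b). a + b) (0, 0) ?D"
    by (rule smooth_map_has_tangent_map[OF smooth_add pair charted_at])
  have "has_tangent_map A A (\<lambda>a. case (a, 0) of (a, b) \<Rightarrow> a + b) 0 (\<lambda>u. ?D (u, 0))"
    by (rule has_tangent_map_compose[OF charted_at pair
        has_tangent_map_Pair[OF ident has_tangent_map_const] D])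
  then have "has_tangent_map A A (\<lambda>a. a) 0 (\<lambda>u. ?D (u, 0))"
    by simp
  from has_tangent_map_unique[OF this ident] have left: "?D (u, 0) = u" for u
    by meson
  have "has_tangent_map A A (\<lambda>a. case (0, a) of (a, b) \<Rightarrow> a + b) 0 (\<lambda>u. ?D (0, u))"
    by (rule has_tangent_map_compose[OF charted_at pair
        has_tangent_map_Pair[OF has_tangent_map_const ident] D])
  then have "has_tangent_map A A (\<lambda>a. a) 0 (\<lambda>u. ?D (0, u))"
    by simp
  from has_tangent_map_unique[OF this ident] have right: "?D (0, u) = u" for u
    by meson
  have "?D (u, v) = u + v" for u v
    using blinfun.add_right[of "tangent_map (A \<times>\<^sub>M A) A (\<lambda>(a, b). a + b) (0, 0)" "(u, 0)" "(0, v)"]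
    by (simp add: left right)
  then have "?D = (\<lambda>(u, v). u + v)" by auto
  then show ?thesis using D by simp
qed

lemma has_tangent_map_add:
  assumes "charted_at M p" and f: "has_tangent_map M A f p D" "f p = 0"
    and g: "has_tangent_map M A g p E" "g p = 0"
  shows "has_tangent_map M A (\<lambda>x. f x + g x) p (\<lambda>v. D v + E v)"
  using has_tangent_map_compose[OF assms(1) _ has_tangent_map_Pair[OF f(1) g(1)], unfolded f(2) g(2),
      OF charted_at_prod[OF charted_at charted_at] tangent_add]
  by simp

text \<open>Obtained by differentiating \<open>a + - a = 0\<close> at 0.\<close>

lemma tangent_uminus: "has_tangent_map A A uminus 0 uminus"
proof -
  let ?D = "blinfun_apply (tangent_map A A uminus 0)"
  have D: "has_tangent_map A A uminus 0 ?D"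
    by (rule smooth_map_has_tangent_map[OF smooth_uminus charted_at charted_at])
  have "has_tangent_map A A (\<lambda>a. a + - a) 0 (\<lambda>v. v + ?D v)"
    by (rule has_tangent_map_add[OF charted_at has_tangent_map_ident[OF charted_at] _ D]) auto
  then have "has_tangent_map A A (\<lambda>_. 0) 0 (\<lambda>v. v + ?D v)"
    by simp
  from has_tangent_map_unique[OF this has_tangent_map_const] have "(\<lambda>v. v + ?D v) = (\<lambda>_. 0)" .
  then have "?D = uminus"
    by (auto simp: fun_eq_iff eq_neg_iff_add_eq_0 add.commute)
  then show ?thesis using D by simp
qed

lemma has_tangent_map_diff:
  assumes "charted_at M p" and f: "has_tangent_map M A f p D" "f p = 0"
    and g: "has_tangent_map M A g p E" "g p = 0"
  shows "has_tangent_map M A (\<lambda>x. f x - g x) p (\<lambda>v. D v - E v)"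
proof -
  have "has_tangent_map M A (\<lambda>x. - g x) p (\<lambda>v. - E v)"
    by (rule has_tangent_map_compose[OF assms(1) charted_at g(1)]) (simp add: g(2) tangent_uminus)
  from has_tangent_map_add[OF assms(1) f this] show ?thesis using g(2) by simp
qed

end

section \<open>Linearised rack actions and the induced brackets\<close>

locale rack_action = lie_rack X rack one + abelian_lie_group A
  for X :: "('x::{t2_space, second_countable_topology}, 'e::model_space) charted"
    and rack :: "'x \<Rightarrow> 'x \<Rightarrow> 'x" (infixr "\<rhd>" 75)
    and one :: 'x ("\<one>")
    and A :: "('a::{ab_group_add, t2_space, second_countable_topology}, 'f::model_space) charted" +
  fixes \<rho> :: "'x \<Rightarrow> 'a \<Rightarrow> 'a"
  assumes action: "smooth_rack_action X rack \<one> A \<rho>"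
begin

definition T where "T x = tangent_map A A (\<rho> x) 0"

text \<open>The infinitesimal action of the Leibniz algebra of \<open>X\<close> on the Lie algebra
  of \<open>A\<close>; not to be confused with \<open>rack_ad\<close>, which acts on the Leibniz
  algebra itself.\<close>

definition ad where "ad = tangent_map X vector_manifold T \<one>"

lemmas charted_X = lie_rack_axioms[THEN lie_rack.axioms(1), THEN smooth_manifold.charted_at]
lemmas charted_A = abelian_lie_group_axioms[THEN abelian_lie_group.axioms(1), THEN smooth_manifold.charted_at]

lemma smooth_\<rho>: "smooth_map A A (\<rho> x)"
  using action by (simp add: smooth_rack_action_def lie_group_automorphism_def diffeomorphism_def)

lemma \<rho>_zero: "\<rho> x 0 = 0"
proof -
  have "\<rho> x (0 + 0) = \<rho> x 0 + \<rho> x 0"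
    using action unfolding smooth_rack_action_def lie_group_automorphism_def by blast
  then show ?thesis by simp
qed

text \<open>The conjugation law with its inverse cleared, the form in which functoriality gives an
  identity between compositions of tangent maps.\<close>

lemma \<rho>_rack: "\<rho> (x \<rhd> y) (\<rho> x a) = \<rho> x (\<rho> y a)"
proof -
  have "inj (\<rho> x)" and "\<rho> (x \<rhd> y) = \<rho> x \<circ> \<rho> y \<circ> inv (\<rho> x)"
    using action
    by (auto simp: smooth_rack_action_def lie_group_automorphism_def diffeomorphism_def bij_is_inj)
  then show ?thesis by simp
qed

lemma has_tangent_map_\<rho>: "has_tangent_map A A (\<rho> x) 0 (blinfun_apply (T x))"
  unfolding T_def by (rule smooth_map_has_tangent_map[OF smooth_\<rho> charted_A charted_A])

lemma has_tangent_map_T: "has_tangent_map X vector_manifold T \<one> (blinfun_apply ad)"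
  unfolding ad_def T_def
  using action
  by (intro tangent_map_family charted_X charted_A \<rho>_zero) (simp add: smooth_rack_action_def)

lemma T_one: "T \<one> = id_blinfun"
  using action by (simp add: T_def smooth_rack_action_def id_def tangent_map_ident[OF charted_A])

lemma T_rack: "T (x \<rhd> y) o\<^sub>L T x = T x o\<^sub>L T y"
proof -
  have "tangent_map A A (\<lambda>a. \<rho> (x \<rhd> y) (\<rho> x a)) 0 = tangent_map A A (\<lambda>a. \<rho> x (\<rho> y a)) 0"
    by (simp add: \<rho>_rack)
  then show ?thesis
    by (simp add: tangent_map_compose[where N = A] smooth_\<rho> charted_A \<rho>_zero T_def)
qed

lemma ad_bracket:
  "ad (rack_bracket X rack \<one> u v) m = ad u (ad v m) - ad v (ad u m)"
  by (simp add: tangent_equivariant_action[OF has_tangent_map_T T_one T_rack] blinfun.diff_left)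

text \<open>Here \<open>linearization A \<phi>\<close> is \<open>T\<close> after the first
  projection, so the chain rule in direction \<open>(u, 0)\<close> leaves
  \<open>ad u\<close>.\<close>

lemma induced_left_eq:
  assumes "\<And>x y a. \<phi> x y a = \<rho> x a"
  shows "induced_left X \<one> A \<phi> u m = ad u m"
proof -
  have "linearization A \<phi> = (\<lambda>z. T (fst z))"
    using assms by (auto simp: linearization_def T_def fun_eq_iff intro!: arg_cong[of _ _ "\<lambda>f. tangent_map A A f 0"])
  moreover have "has_tangent_map (X \<times>\<^sub>M X) vector_manifold (\<lambda>z. T (fst z)) (\<one>, \<one>) (\<lambda>z. ad (fst z))"
    by (rule has_tangent_map_compose[OF charted_at_prod[OF charted_X charted_X] charted_X
          has_tangent_map_fst[OF charted_X charted_X]]) (simp add: has_tangent_map_T)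
  ultimately show ?thesis
    by (simp add: induced_left_def tangent_map_eq)
qed

lemma induced_right_eq:
  assumes "\<And>x y a. \<psi> x y a = a - \<rho> (x \<rhd> y) a"
  shows "induced_right X \<one> A \<psi> m u = - ad u m"
proof -
  note XX = charted_at_prod[OF charted_X charted_X]
  let ?r = "\<lambda>(x, y). x \<rhd> y"
  let ?E = "blinfun_apply (tangent_map (X \<times>\<^sub>M X) X ?r (\<one>, \<one>))"
  have E: "has_tangent_map (X \<times>\<^sub>M X) X ?r (\<one>, \<one>) ?E"
    by (rule smooth_map_has_tangent_map[OF smooth_rack XX charted_X])
  \<comment> \<open>Restricting the product to pairs with first entry \<open>\<one>\<close> computes
    its derivative in direction \<open>(0, v)\<close>: the axiom \<open>\<one> \<rhd> y = y\<close>
    makes it \<open>v\<close>.\<close>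
  have "has_tangent_map X X (\<lambda>y. ?r (\<one>, y)) \<one> (\<lambda>v. ?E (0, v))"
    by (rule has_tangent_map_compose[OF charted_X XX
        has_tangent_map_Pair[OF has_tangent_map_const has_tangent_map_ident[OF charted_X]] E])
  then have "has_tangent_map X X (\<lambda>y. y) \<one> (\<lambda>v. ?E (0, v))"
    by (simp add: one_left)
  from has_tangent_map_unique[OF this has_tangent_map_ident[OF charted_X]]
  have E_right: "?E (0, v) = v" for v
    by meson
  \<comment> \<open>Group subtraction linearises to vector subtraction at 0, and both terms of
    \<open>a - \<rho> (x \<rhd> y) a\<close> vanish at \<open>a = 0\<close>.\<close>
  have "linearization A \<psi> (x, y) = id_blinfun - T (x \<rhd> y)" for x y
  proof (rule blinfun_eqI)
    have "\<psi> x y = (\<lambda>a. a - \<rho> (x \<rhd> y) a)"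
      using assms by auto
    then have "has_tangent_map A A (\<psi> x y) 0 (\<lambda>v. v - T (x \<rhd> y) v)"
      by (simp add: has_tangent_map_diff[OF charted_A has_tangent_map_ident[OF charted_A]]
          has_tangent_map_\<rho> \<rho>_zero)
    then show "linearization A \<psi> (x, y) m = (id_blinfun - T (x \<rhd> y)) m" for m
      by (simp add: linearization_def tangent_map_eq blinfun.diff_left)
  qed
  then have lin: "linearization A \<psi> = (\<lambda>z. id_blinfun - T (?r z))"
    by auto
  have "has_tangent_map (X \<times>\<^sub>M X) vector_manifold (\<lambda>z. T (?r z)) (\<one>, \<one>) (\<lambda>z. ad (?E z))"
    by (rule has_tangent_map_compose[OF XX charted_X E]) (simp add: one_left has_tangent_map_T)
  \<comment> \<open>The constant \<open>id_blinfun\<close> has derivative 0, which leaves the minus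
    sign of the right bracket.\<close>
  then have "has_tangent_map (X \<times>\<^sub>M X) vector_manifold (\<lambda>z. id_blinfun - T (?r z)) (\<one>, \<one>)
      (\<lambda>z. 0 - ad (?E z))"
    by (rule has_tangent_map_vectorI[OF XX has_derivative_diff[OF has_derivative_const
          has_tangent_map_vectorD]])
  then show ?thesis
    by (simp add: induced_right_def lin tangent_map_eq E_right blinfun.minus_left)
qed

end

text \<open>The rule for constant maps is applied twice: to each \<open>\<psi> x y\<close>, and then
  to the resulting constant linearisation.\<close>

lemma induced_right_zero:
  fixes X :: "('x::t2_space, 'e::real_normed_vector) charted"
    and A :: "('a::{zero, t2_space}, 'f::real_normed_vector) charted"
  assumes "\<And>x y a. \<psi> x y a = 0"
  shows "induced_right X one A \<psi> m u = 0"
proof -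
  have "\<psi> x y = (\<lambda>_. 0)" for x y
    using assms by auto
  then have "linearization A \<psi> = (\<lambda>_. 0)"
    by (auto simp: linearization_def tangent_map_eq[OF has_tangent_map_const] intro!: ext blinfun_eqI)
  then show ?thesis
    by (simp add: induced_right_def tangent_map_eq[OF has_tangent_map_const])
qed

theorem proposition3p6:
  fixes X :: "('x::{t2_space, second_countable_topology}, 'e::model_space) charted"
    and rack :: "'x \<Rightarrow> 'x \<Rightarrow> 'x"
    and one :: 'x
    and A :: "('a::{ab_group_add, t2_space, second_countable_topology}, 'f::model_space) charted"
    and \<phi> \<psi> :: "'x \<Rightarrow> 'x \<Rightarrow> 'a \<Rightarrow> 'a"
  assumes "lie_rack X rack one"
    and "abelian_lie_group A"
  shows "(smooth_symmetric_module X rack one A \<phi> \<psi> \<longrightarrow>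
            symmetric_representation (rack_bracket X rack one)
              (induced_left X one A \<phi>) (induced_right X one A \<psi>)) \<and>
         (smooth_antisymmetric_module X rack one A \<phi> \<psi> \<longrightarrow>
            antisymmetric_representation (rack_bracket X rack one)
              (induced_left X one A \<phi>) (induced_right X one A \<psi>))"
proof (intro conjI impI)
  \<comment> \<open>With the Leibniz algebra part in place, \<open>unfold_locales\<close> leaves
    only the module axioms in both cases.\<close>
  interpret leibniz_algebra "rack_bracket X rack one"
    using assms(1) by (rule lie_rack.leibniz_algebra_rack_bracket)
  note linear = bilinear_def linear_iff
    blinfun.add_left blinfun.add_right blinfun.scaleR_left blinfun.scaleR_right
  {
    assume "smooth_symmetric_module X rack one A \<phi> \<psi>"
    then obtain \<rho> where \<rho>: "smooth_rack_action X rack one A \<rho>"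
      and \<phi>: "\<And>x y a. \<phi> x y a = \<rho> x a" and \<psi>: "\<And>x y a. \<psi> x y a = a - \<rho> (rack x y) a"
      unfolding smooth_symmetric_module_def by blast
    interpret rack_action X rack one A \<rho>
      using assms \<rho> by (simp add: rack_action_def rack_action_axioms_def)
    have L: "induced_left X one A \<phi> = (\<lambda>u m. ad u m)"
      and R: "induced_right X one A \<psi> = (\<lambda>m u. - ad u m)"
      by (simp_all add: induced_left_eq[OF \<phi>] induced_right_eq[OF \<psi>] fun_eq_iff)
    \<comment> \<open>With left action \<open>ad\<close> and right action its negative, each of the
      three module axioms is \<open>ad_bracket\<close> up to signs and rearrangement.\<close>
    show "symmetric_representation (rack_bracket X rack one)
        (induced_left X one A \<phi>) (induced_right X one A \<psi>)"
      unfolding L R by unfold_locales (simp_all add: linear ad_bracket blinfun.minus_right)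
  }
  {
    assume "smooth_antisymmetric_module X rack one A \<phi> \<psi>"
    then obtain \<rho> where \<rho>: "smooth_rack_action X rack one A \<rho>"
      and \<phi>: "\<And>x y a. \<phi> x y a = \<rho> x a" and \<psi>: "\<And>x y a. \<psi> x y a = 0"
      unfolding smooth_antisymmetric_module_def by blast
    interpret rack_action X rack one A \<rho>
      using assms \<rho> by (simp add: rack_action_def rack_action_axioms_def)
    have L: "induced_left X one A \<phi> = (\<lambda>u m. ad u m)"
      and R: "induced_right X one A \<psi> = (\<lambda>m u. 0)"
      by (simp_all add: induced_left_eq[OF \<phi>] induced_right_zero[OF \<psi>] fun_eq_iff)
    \<comment> \<open>The right action is 0, so the two axioms involving it read
      \<open>0 = 0\<close>, and the one for the left action is \<open>ad_bracket\<close>.\<close>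
    show "antisymmetric_representation (rack_bracket X rack one)
        (induced_left X one A \<phi>) (induced_right X one A \<psi>)"
      unfolding L R by unfold_locales (simp_all add: linear ad_bracket)
  }
qed

end
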